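(* Let $f\in\mathcal{C}^1(\mathbb{R}^d;\mathbb{R}^d)$ and $g\in\mathcal{C}^1(\mathbb{R}^d;\mathbb{R}^{d\times m})$, and suppose there are $\mu\in\mathbb{R}$ and $L>0$ such that $$\langle x-y,f(x)-f(y)\rangle\le\mu|x-y|^2,\qquad |g(x)-g(y)|^2\le L|x-y|^2\qquad\forall x,y\in\mathbb{R}^d,$$ with $\alpha=2\mu+L<0$. Let $\theta\in[0,1]$, let $X(t),Y(t)$ be solutions of the It\^o SDE $dX(t)=f(X(t))dt+g(X(t))dW(t)$, $t\in[0,T]$, with initial values $X_0,Y_0$ satisfying $\mathbb{E}|X_0|^2<\infty$, $\mathbb{E}|Y_0|^2<\infty$, let $M=\sup_{t\in[0,T]}\mathbb{E}|f'(X(t))|^2$, let $\widetilde M$ be the constant defined in the context, and let $$\mathcal{R}=\begin{cases}\left(0,\dfrac{4|\alpha|}{4(1-\theta)^2M+3\widetilde M}\right),&\theta<1,\\[5mm]\left(0,\dfrac{4|\alpha|}{3\widetilde M}\right),&\theta=1.\end{cases}$$ Then $0<\gamma(\theta,\Delta t)<1$ for every $\Delta t\in\mathcal{R}$; that is, the $\theta$-Milstein method $$X_{n+1}=X_n+(1-\theta)\Delta t f(X_n)+\theta\Delta t f(X_{n+1})+\sum_{j=1}^m g^j(X_n)\Delta W_n^j+\frac12\sum_{j=1}^mL^jg^j(X_n)\big((\Delta W_n^j)^2-\Delta t\big)+\frac12\sum_{\substack{j_1,j_2=1\\ j_1\neq j_2}}^mL^{j_1}g^{j_2}(X_n)\Delta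 W_n^{j_1}\Delta W_n^{j_2}$$ generates mean-square contractive numerical solutions in the region $\mathcal{R}$.
   Context: $W(t)$ is an $m$-dimensional Wiener process. $|\cdot|$ denotes the Euclidean norm on $\mathbb{R}^d$ and the trace (Frobenius) norm on matrices; $\langle\cdot,\cdot\rangle$ is the Euclidean inner product; $f'$ is the Jacobian of $f$; $\mathbb{R}^+=(0,\infty)$. $g^j$ is the $j$-th column of $g$, $g^{k,j}$ its $(k,j)$ entry, $L^j=\sum_{k=1}^d g^{k,j}\frac{\partial}{\partial x^k}$, and $\Delta W_n=W(t_{n+1})-W(t_n)$ with $t_n=n\Delta t$. The constant $\widetilde M$ is $$\widetilde M=\sum_{i,j=1}^m\sum_{k,l=1}^d\widetilde M_{i,j}^{k,l},\qquad \widetilde M_{i,j}^{k,l}=\sup_{t\in[0,T]}\frac{\mathbb{E}\big(h_{i,j}^{k,l}(X(t),Y(t))\big)}{\mathbb{E}|X(t)-Y(t)|^2},$$ $$h_{i,j}^{k,l}(x,y)=\Big\langle g^{k,i}(x)\frac{\partial g^j}{\partial x^k}(x)-g^{k,i}(y)\frac{\partial g^j}{\partial x^k}(y),\ g^{l,i}(x)\frac{\partial g^j}{\partial x^l}(x)-g^{l,i}(y)\frac{\partial g^j}{\partial x^l}(y)\Big\rangle .$$ Define $$\beta(\theta,\Delta t)=1+\frac{\alpha+(1-\theta)^2M\Delta t}{1-2\theta\mu\Delta t}\,\Delta t,\quad \gamma(\theta,\Delta t)=\beta(\theta,\Delta t)+\frac{3\widetilde M\Delta t^2}{4(1-2\theta\mu\Delta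 t)},\quad \epsilon(\theta,\Delta t)=\frac1{\Delta t}\ln\gamma(\theta,\Delta t).$$ ($\epsilon(\theta,\Delta t)$ is the exponent in the stability inequality $\mathbb{E}|X_n-Y_n|^2\le\mathbb{E}|X_0-Y_0|^2e^{\epsilon(\theta,\Delta t)t_n}$ for two numerical solutions of the method.) For fixed $\theta\in[0,1]$, the $\theta$-Milstein method is said to generate mean-square contractive numerical solutions in a region $\mathcal{R}\subseteq\mathbb{R}^+$ if $\epsilon(\theta,\Delta t)<0$ for all $\Delta t\in\mathcal{R}$. Standing assumption: the SDE is commutative, i.e. $L^{j_1}g^{j_2}=L^{j_2}g^{j_1}$ for all $j_1,j_2$. *)

theory Defs
  imports "HOL-Probability.Probability"
begin

section \<open>Continuously differentiable maps and partial derivatives\<close>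

definition C1_map :: "('a::real_normed_vector \<Rightarrow> 'b::real_normed_vector) \<Rightarrow> bool" where
  "C1_map f \<longleftrightarrow> (\<exists>f' :: 'a \<Rightarrow> 'a \<Rightarrow>\<^sub>L 'b.
     (\<forall>x. (f has_derivative blinfun_apply (f' x)) (at x)) \<and> continuous_on UNIV f')"

definition partial_deriv :: "(real^'d \<Rightarrow> 'b::real_normed_vector) \<Rightarrow> 'd \<Rightarrow> real^'d \<Rightarrow> 'b" where
  "partial_deriv \<phi> k x = frechet_derivative \<phi> (at x) (axis k 1)"

text \<open>
  A diffusion coefficient with values in the \<open>d \<times> m\<close> matrices has type
  \<open>real^'d \<Rightarrow> real^'m^'d\<close>: \<open>g x $ k $ j\<close> is the entry in row \<open>k\<close>, column \<open>j\<close>.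
  The norm of this type is the Frobenius norm.
\<close>

definition L_op ::
  "(real^'d \<Rightarrow> real^'m^'d) \<Rightarrow> 'm \<Rightarrow> (real^'d \<Rightarrow> 'b::real_normed_vector) \<Rightarrow> real^'d \<Rightarrow> 'b" where
  "L_op g j \<phi> x = (\<Sum>k\<in>UNIV. (g x $ k $ j) *\<^sub>R partial_deriv \<phi> k x)"

definition commutative_noise :: "(real^'d \<Rightarrow> real^'m^'d) \<Rightarrow> bool" where
  "commutative_noise g \<longleftrightarrow>
     (\<forall>j1 j2 x. L_op g j1 (\<lambda>z. column j2 (g z)) x = L_op g j2 (\<lambda>z. column j1 (g z)) x)"


section \<open>Wiener processes, It\^o integrals and solutions of SDEs\<close>

text \<open>
  Time runs over the nonnegative reals. The library's filtrations are indexed by all of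
  \<open>real\<close>; the \<open>\<sigma>\<close>-algebras at negative times play no role (take them equal to \<open>F 0\<close>).
\<close>

definition wiener_process ::
  "'w measure \<Rightarrow> (real \<Rightarrow> 'w measure) \<Rightarrow> (real \<Rightarrow> 'w \<Rightarrow> real^'m) \<Rightarrow> bool" where
  "wiener_process P F W \<longleftrightarrow>
     prob_space P \<and> filtration (space P) F \<and> (\<forall>t. sets (F t) \<subseteq> sets P) \<and>
     (\<forall>t\<ge>0. W t \<in> borel_measurable (F t)) \<and>
     (AE \<omega> in P. W 0 \<omega> = 0) \<and>
     (AE \<omega> in P. continuous_on {0..} (\<lambda>t. W t \<omega>)) \<and>
     (\<forall>s t. 0 \<le> s \<and> s < t \<longrightarrow>
        prob_space.indep_set P (sets (F s))
          {(\<lambda>\<omega>. W t \<omega> - W s \<omega>) -` B \<inter> space P | B. B \<in> sets borel} \<and>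
        distributed P lborel (\<lambda>\<omega>. W t \<omega> - W s \<omega>)
          (\<lambda>x. ennreal (\<Prod>j\<in>UNIV. normal_density 0 (sqrt (t - s)) (x $ j))))"

text \<open>
  A simple integrand is \<open>\<Sum>i<n. \<xi> i\<close> on \<open>(\<tau> i, \<tau> (i+1)]\<close>, for a partition
  \<open>0 = \<tau> 0 < \<dots> < \<tau> n = T\<close> and bounded \<open>\<xi> i\<close> measurable with respect to \<open>F (\<tau> i)\<close>.
\<close>

definition simple_integrand ::
  "(real \<Rightarrow> 'w measure) \<Rightarrow> real \<Rightarrow> nat \<Rightarrow> (nat \<Rightarrow> real) \<Rightarrow> (nat \<Rightarrow> 'w \<Rightarrow> real^'m^'d) \<Rightarrow> bool" where
  "simple_integrand F T n \<tau> \<xi> \<longleftrightarrow>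
     \<tau> 0 = 0 \<and> \<tau> n = T \<and> (\<forall>i<n. \<tau> i < \<tau> (Suc i)) \<and>
     (\<forall>i<n. \<xi> i \<in> borel_measurable (F (\<tau> i)) \<and>
             (\<exists>C. \<forall>\<omega>\<in>space (F (\<tau> i)). norm (\<xi> i \<omega>) \<le> C))"

definition simple_path ::
  "nat \<Rightarrow> (nat \<Rightarrow> real) \<Rightarrow> (nat \<Rightarrow> 'w \<Rightarrow> real^'m^'d) \<Rightarrow> real \<Rightarrow> 'w \<Rightarrow> real^'m^'d" where
  "simple_path n \<tau> \<xi> t \<omega> = (\<Sum>i<n. indicator {\<tau> i<..\<tau> (Suc i)} t *\<^sub>R \<xi> i \<omega>)"

definition simple_ito_integral ::
  "(real \<Rightarrow> 'w \<Rightarrow> real^'m) \<Rightarrow> nat \<Rightarrow> (nat \<Rightarrow> real) \<Rightarrow> (nat \<Rightarrow> 'w \<Rightarrow> real^'m^'d)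
     \<Rightarrow> real \<Rightarrow> 'w \<Rightarrow> real^'d" where
  "simple_ito_integral W n \<tau> \<xi> t \<omega> =
     (\<Sum>i<n. \<xi> i \<omega> *v (W (min t (\<tau> (Suc i))) \<omega> - W (min t (\<tau> i)) \<omega>))"

text \<open>
  \<open>I t\<close> is the It\^o integral of \<open>H\<close> over \<open>[0, t]\<close>, for all \<open>t \<in> [0, T]\<close>: the limit of the integrals
  of simple integrands \<open>H\<^sub>k\<close> with \<open>\<integral>\<^sub>0\<^sup>T |H - H\<^sub>k|\<^sup>2 ds \<longrightarrow> 0\<close>. The textbook
  definition takes both limits in probability (the second one uniformly on \<open>[0, T]\<close>); passing to a
  subsequence gives the equivalent almost sure form used here, which involves no
  measurability questions about uncountable suprema.
\<close>

definition is_ito_integral ::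
  "'w measure \<Rightarrow> (real \<Rightarrow> 'w measure) \<Rightarrow> (real \<Rightarrow> 'w \<Rightarrow> real^'m) \<Rightarrow> real
     \<Rightarrow> (real \<Rightarrow> 'w \<Rightarrow> real^'m^'d) \<Rightarrow> (real \<Rightarrow> 'w \<Rightarrow> real^'d) \<Rightarrow> bool" where
  "is_ito_integral P F W T H I \<longleftrightarrow>
     (\<exists>n \<tau> \<xi>. (\<forall>k. simple_integrand F T (n k) (\<tau> k) (\<xi> k)) \<and>
        (AE \<omega> in P.
           (\<lambda>k. \<integral>\<^sup>+s\<in>{0..T}. ennreal ((norm (H s \<omega> - simple_path (n k) (\<tau> k) (\<xi> k) s \<omega>))\<^sup>2) \<partial>lborel)
             \<longlonglongrightarrow> 0 \<and>
           uniform_limit {0..T} (\<lambda>k t. simple_ito_integral W (n k) (\<tau> k) (\<xi> k) t \<omega>)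
             (\<lambda>t. I t \<omega>) sequentially))"

definition sde_solution ::
  "'w measure \<Rightarrow> (real \<Rightarrow> 'w measure) \<Rightarrow> (real \<Rightarrow> 'w \<Rightarrow> real^'m) \<Rightarrow> real
     \<Rightarrow> (real^'d \<Rightarrow> real^'d) \<Rightarrow> (real^'d \<Rightarrow> real^'m^'d) \<Rightarrow> (real \<Rightarrow> 'w \<Rightarrow> real^'d) \<Rightarrow> bool" where
  "sde_solution P F W T f g X \<longleftrightarrow>
     (\<forall>t\<in>{0..T}. X t \<in> borel_measurable (F t)) \<and>
     (AE \<omega> in P. continuous_on {0..T} (\<lambda>t. X t \<omega>)) \<and>
     (\<exists>I. is_ito_integral P F W T (\<lambda>t \<omega>. g (X t \<omega>)) I \<and>
        (AE \<omega> in P. \<forall>t\<in>{0..T}. X t \<omega> = X 0 \<omega> + (LBINT s:{0..t}. f (X s \<omega>)) + I t \<omega>))"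


section \<open>The \<open>\<theta>\<close>-Milstein method and its stability constants\<close>

definition theta_milstein ::
  "'w measure \<Rightarrow> (real \<Rightarrow> 'w \<Rightarrow> real^'m) \<Rightarrow> (real^'d \<Rightarrow> real^'d) \<Rightarrow> (real^'d \<Rightarrow> real^'m^'d)
     \<Rightarrow> real \<Rightarrow> real \<Rightarrow> (nat \<Rightarrow> 'w \<Rightarrow> real^'d) \<Rightarrow> bool" where
  "theta_milstein P W f g \<theta> \<Delta>t X \<longleftrightarrow>
     (\<forall>n. AE \<omega> in P.
        (let \<Delta>W = W (real (Suc n) * \<Delta>t) \<omega> - W (real n * \<Delta>t) \<omega>; x = X n \<omega>; x' = X (Suc n) \<omega>
         in x' = x + ((1 - \<theta>) * \<Delta>t) *\<^sub>R f x + (\<theta> * \<Delta>t) *\<^sub>R f x'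
               + (\<Sum>j\<in>UNIV. (\<Delta>W $ j) *\<^sub>R column j (g x))
               + (1 / 2) *\<^sub>R (\<Sum>j\<in>UNIV. ((\<Delta>W $ j)\<^sup>2 - \<Delta>t) *\<^sub>R L_op g j (\<lambda>z. column j (g z)) x)
               + (1 / 2) *\<^sub>R (\<Sum>j1\<in>UNIV. \<Sum>j2\<in>UNIV - {j1}.
                   (\<Delta>W $ j1 * \<Delta>W $ j2) *\<^sub>R L_op g j1 (\<lambda>z. column j2 (g z)) x)))"

text \<open>
  The expectation of a real random variable as an extended real; unlike the Bochner integral it is
  \<open>\<infinity>\<close>, not \<open>0\<close>, on nonnegative variables that are not integrable.
\<close>

definition eexpectation :: "'w measure \<Rightarrow> ('w \<Rightarrow> real) \<Rightarrow> ereal" where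
  "eexpectation P Z =
     enn2ereal (\<integral>\<^sup>+\<omega>. ennreal (Z \<omega>) \<partial>P) - enn2ereal (\<integral>\<^sup>+\<omega>. ennreal (- Z \<omega>) \<partial>P)"

definition M_const ::
  "'w measure \<Rightarrow> real \<Rightarrow> (real^'d \<Rightarrow> real^'d) \<Rightarrow> (real \<Rightarrow> 'w \<Rightarrow> real^'d) \<Rightarrow> ereal" where
  "M_const P T f X = (SUP t\<in>{0..T}. eexpectation P (\<lambda>\<omega>. (norm (jacobian f (at (X t \<omega>))))\<^sup>2))"

definition milstein_h ::
  "(real^'d \<Rightarrow> real^'m^'d) \<Rightarrow> 'm \<Rightarrow> 'm \<Rightarrow> 'd \<Rightarrow> 'd \<Rightarrow> real^'d \<Rightarrow> real^'d \<Rightarrow> real" where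
  "milstein_h g i j k l x y =
     ((g x $ k $ i) *\<^sub>R partial_deriv (\<lambda>z. column j (g z)) k x
        - (g y $ k $ i) *\<^sub>R partial_deriv (\<lambda>z. column j (g z)) k y) \<bullet>
     ((g x $ l $ i) *\<^sub>R partial_deriv (\<lambda>z. column j (g z)) l x
        - (g y $ l $ i) *\<^sub>R partial_deriv (\<lambda>z. column j (g z)) l y)"

text \<open>
  At times where \<open>X t = Y t\<close> almost surely the quotient below is \<open>0 / 0\<close>, which is \<open>0\<close> in \<open>ereal\<close>.
\<close>

definition Mtilde_const ::
  "'w measure \<Rightarrow> real \<Rightarrow> (real^'d \<Rightarrow> real^'m^'d)
     \<Rightarrow> (real \<Rightarrow> 'w \<Rightarrow> real^'d) \<Rightarrow> (real \<Rightarrow> 'w \<Rightarrow> real^'d) \<Rightarrow> ereal" where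
  "Mtilde_const P T g X Y =
     (\<Sum>i\<in>UNIV. \<Sum>j\<in>UNIV. \<Sum>k\<in>UNIV. \<Sum>l\<in>UNIV.
        (SUP t\<in>{0..T}. eexpectation P (\<lambda>\<omega>. milstein_h g i j k l (X t \<omega>) (Y t \<omega>)) /
                       eexpectation P (\<lambda>\<omega>. (norm (X t \<omega> - Y t \<omega>))\<^sup>2)))"

definition milstein_beta :: "real \<Rightarrow> real \<Rightarrow> real \<Rightarrow> real \<Rightarrow> real \<Rightarrow> real" where
  "milstein_beta \<alpha> \<mu> M \<theta> \<Delta>t =
     1 + (\<alpha> + (1 - \<theta>)\<^sup>2 * M * \<Delta>t) / (1 - 2 * \<theta> * \<mu> * \<Delta>t) * \<Delta>t"

definition milstein_gamma :: "real \<Rightarrow> real \<Rightarrow> real \<Rightarrow> real \<Rightarrow> real \<Rightarrow> real \<Rightarrow> real" where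
  "milstein_gamma \<alpha> \<mu> M Mt \<theta> \<Delta>t =
     milstein_beta \<alpha> \<mu> M \<theta> \<Delta>t + 3 * Mt * \<Delta>t\<^sup>2 / (4 * (1 - 2 * \<theta> * \<mu> * \<Delta>t))"

definition milstein_epsilon :: "real \<Rightarrow> real \<Rightarrow> real \<Rightarrow> real \<Rightarrow> real \<Rightarrow> real \<Rightarrow> real" where
  "milstein_epsilon \<alpha> \<mu> M Mt \<theta> \<Delta>t = 1 / \<Delta>t * ln (milstein_gamma \<alpha> \<mu> M Mt \<theta> \<Delta>t)"

text \<open>
  The \<open>\<theta>\<close>-Milstein method (\<open>theta_milstein\<close>) is, by definition, said to generate mean-square contractive
  numerical solutions in a region \<open>R\<close> of step sizes if \<open>milstein_epsilon\<close>, the exponent in its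
  stability inequality \<open>E |X\<^sub>n - Y\<^sub>n|\<^sup>2 \<le> E |X\<^sub>0 - Y\<^sub>0|\<^sup>2 exp (\<epsilon> t\<^sub>n)\<close>, is negative on \<open>R\<close>;
  the notion refers to the method through this exponent only.
\<close>

definition mean_square_contractive ::
  "real \<Rightarrow> real \<Rightarrow> real \<Rightarrow> real \<Rightarrow> real \<Rightarrow> real set \<Rightarrow> bool" where
  "mean_square_contractive \<alpha> \<mu> M Mt \<theta> R \<longleftrightarrow>
     R \<subseteq> {0<..} \<and> (\<forall>\<Delta>t\<in>R. milstein_epsilon \<alpha> \<mu> M Mt \<theta> \<Delta>t < 0)"

text \<open>
  The upper end point is an extended real: it is \<open>\<infinity>\<close> if the denominator vanishes
  and \<open>0\<close> if the denominator is infinite.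
\<close>

definition contractivity_region :: "real \<Rightarrow> ereal \<Rightarrow> ereal \<Rightarrow> real \<Rightarrow> real set" where
  "contractivity_region \<alpha> M Mt \<theta> =
     {\<Delta>t. 0 < \<Delta>t \<and>
        ereal \<Delta>t < (if \<theta> < 1 then ereal (4 * \<bar>\<alpha>\<bar>) / (ereal (4 * (1 - \<theta>)\<^sup>2) * M + ereal 3 * Mt)
                    else ereal (4 * \<bar>\<alpha>\<bar>) / (ereal 3 * Mt))}"

end

theory Submission
  imports Defs
begin

text \<open>
  Multiplying \<open>\<gamma> < 1\<close> by \<open>1 - 2\<theta>\<mu>\<Delta>t \<ge> 1\<close> turns it into \<open>\<Delta>t < 4|\<alpha>| / (4(1-\<theta>)\<^sup>2M + 3Mt)\<close>, and
  \<open>\<gamma> > 0\<close> into the positivity of \<open>1 + 2(1-\<theta>)\<mu>\<Delta>t + L\<Delta>t + ((1-\<theta>)\<^sup>2M + 3Mt/4)\<Delta>t\<^sup>2\<close>. Both need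
  two facts about the constants. First, \<open>M \<ge> \<mu>\<^sup>2\<close>: differentiating the one-sided Lipschitz condition
  bounds every diagonal entry of \<open>f'\<close> by \<open>\<mu> < 0\<close>; this completes the square
  \<open>(1 + (1-\<theta>)\<mu>\<Delta>t)\<^sup>2\<close>. Secondly, \<open>Mt \<ge> 0\<close>, although single summands of \<open>Mt\<close> may be negative: the
  suprema dominate the values at \<open>t = 0\<close>, and the sum over \<open>k, l\<close> of these is the expectation of a
  squared norm. Infinite \<open>M\<close> or \<open>Mt\<close> is harmless, since a step size region with an infinite
  denominator is empty.
\<close>

section \<open>The one-sided Lipschitz condition and the Jacobian\<close>

text \<open>Along the ray from \<open>x\<close> in direction \<open>v\<close>, the defect
  \<open>\<phi>\<close> of the condition divided by the step vanishes at 0 and is nonpositive for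
  positive steps, so its derivative at 0 cannot be positive.\<close>

lemma one_sided_Lipschitz_derivative:
  fixes f :: "'a::real_inner \<Rightarrow> 'a"
  assumes mono: "\<And>x y. (x - y) \<bullet> (f x - f y) \<le> \<mu> * (norm (x - y))\<^sup>2"
    and deriv: "(f has_derivative f') (at x)"
  shows "v \<bullet> f' v \<le> \<mu> * (norm v)\<^sup>2"
proof -
  define \<phi> where "\<phi> h = v \<bullet> (f (x + h *\<^sub>R v) - f x) - \<mu> * h * (norm v)\<^sup>2" for h :: real
  interpret f': bounded_linear f' using deriv by (rule has_derivative_bounded_linear)
  have "((\<lambda>h. f (x + h *\<^sub>R v)) has_derivative (\<lambda>h. f' (h *\<^sub>R v))) (at 0)"
    by (rule has_derivative_compose[of "\<lambda>h. x + h *\<^sub>R v" "\<lambda>h. h *\<^sub>R v" 0 UNIV f f'])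
       (use deriv in \<open>auto intro!: derivative_eq_intros\<close>)
  then have "(\<phi> has_derivative (\<lambda>h. v \<bullet> f' (h *\<^sub>R v) - \<mu> * h * (norm v)\<^sup>2)) (at 0)"
    unfolding \<phi>_def by (auto intro!: derivative_eq_intros)
  then have D: "(\<phi> has_real_derivative (v \<bullet> f' v - \<mu> * (norm v)\<^sup>2)) (at 0)"
    unfolding has_field_derivative_def
    by (rule has_derivative_eq_rhs) (auto simp: f'.scaleR algebra_simps)
  have nonpos: "\<phi> h \<le> 0" if "h > 0" for h
  proof -
    have "h * (v \<bullet> (f (x + h *\<^sub>R v) - f x)) \<le> h * (\<mu> * h * (norm v)\<^sup>2)"
      using mono[of "x + h *\<^sub>R v" x] by (simp add: power_mult_distrib power2_eq_square mult_ac)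
    then show ?thesis using that by (simp add: \<phi>_def)
  qed
  show ?thesis
  proof (rule ccontr)
    assume "\<not> ?thesis"
    then have "0 < v \<bullet> f' v - \<mu> * (norm v)\<^sup>2" by simp
    from DERIV_pos_inc_right[OF D this] obtain d where "d > 0"
      and d: "\<And>h. h > 0 \<Longrightarrow> h < d \<Longrightarrow> \<phi> 0 < \<phi> (0 + h)" by blast
    from d[of "d / 2"] nonpos[of "d / 2"] \<open>d > 0\<close> show False by (simp add: \<phi>_def)
  qed
qed

lemma norm_jacobian_ge:
  fixes f :: "real^'d \<Rightarrow> real^'d"
  assumes mono: "\<And>x y. (x - y) \<bullet> (f x - f y) \<le> \<mu> * (norm (x - y))\<^sup>2"
    and "\<mu> \<le> 0" and diff: "f differentiable (at x)"
  shows "\<mu>\<^sup>2 \<le> (norm (jacobian f (at x)))\<^sup>2"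
proof -
  \<comment> \<open>Any single diagonal entry suffices: the Frobenius norm dominates it, and a
    diagonal entry below the nonpositive \<open>\<mu>\<close> is at least as large in
    modulus.\<close>
  fix k :: 'd
  let ?J = "jacobian f (at x)"
  have "(f has_derivative (\<lambda>v. ?J *v v)) (at x)"
    using diff jacobian_works by blast
  from one_sided_Lipschitz_derivative[OF mono this, of "axis k 1"]
  have "?J $ k $ k \<le> \<mu>"
    by (simp add: inner_axis' matrix_vector_mul_component inner_axis)
  then have "\<bar>\<mu>\<bar> \<le> \<bar>?J $ k $ k\<bar>" using \<open>\<mu> \<le> 0\<close> by simp
  also have "\<dots> \<le> norm (?J $ k)" using component_le_norm_cart[of "?J $ k" k] by simp
  also have "\<dots> \<le> norm ?J" by (rule Finite_Cartesian_Product.norm_nth_le)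
  finally show ?thesis using power_mono[of "\<bar>\<mu>\<bar>" "norm ?J" 2] by simp
qed

section \<open>Extended expectations and the lower bound on M\<close>

lemma eexpectation_nonneg:
  "(\<And>\<omega>. 0 \<le> Z \<omega>) \<Longrightarrow> eexpectation P Z = enn2ereal (\<integral>\<^sup>+\<omega>. ennreal (Z \<omega>) \<partial>P)"
  by (simp add: eexpectation_def ennreal_neg zero_ennreal.rep_eq)

lemma eexpectation_cong_AE:
  assumes "AE \<omega> in P. Z \<omega> = Z' \<omega>"
  shows "eexpectation P Z = eexpectation P Z'"
proof -
  have "(\<integral>\<^sup>+\<omega>. ennreal (Z \<omega>) \<partial>P) = (\<integral>\<^sup>+\<omega>. ennreal (Z' \<omega>) \<partial>P)"
    "(\<integral>\<^sup>+\<omega>. ennreal (- Z \<omega>) \<partial>P) = (\<integral>\<^sup>+\<omega>. ennreal (- Z' \<omega>) \<partial>P)"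
    using assms by (auto intro!: nn_integral_cong_AE elim: eventually_mono)
  then show ?thesis by (simp add: eexpectation_def)
qed

lemma eexpectation_integrable:
  assumes "integrable P Z"
  shows "eexpectation P Z = ereal (integral\<^sup>L P Z)"
proof -
  from integrableE[OF assms] obtain r q where "0 \<le> r" "0 \<le> q"
    "(\<integral>\<^sup>+\<omega>. ennreal (Z \<omega>) \<partial>P) = ennreal r" "(\<integral>\<^sup>+\<omega>. ennreal (- Z \<omega>) \<partial>P) = ennreal q"
    "integral\<^sup>L P Z = r - q" .
  then show ?thesis by (simp add: eexpectation_def)
qed

text \<open>Time 0 alone gives the bound: \<open>P\<close> has total mass 1, and the supremum
  dominates its value there.\<close>

lemma M_const_ge:
  fixes f :: "real^'d \<Rightarrow> real^'d"
  assumes "prob_space P" and "0 \<le> T" and "\<And>x. c \<le> (norm (jacobian f (at x)))\<^sup>2" and "0 \<le> c"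
  shows "ereal c \<le> M_const P T f X"
proof -
  interpret prob_space P by fact
  have "ennreal c = (\<integral>\<^sup>+\<omega>. ennreal c \<partial>P)" by (simp add: emeasure_space_1)
  also have "\<dots> \<le> (\<integral>\<^sup>+\<omega>. ennreal ((norm (jacobian f (at (X 0 \<omega>))))\<^sup>2) \<partial>P)"
    by (intro nn_integral_mono ennreal_leI assms)
  finally have "ereal c \<le> eexpectation P (\<lambda>\<omega>. (norm (jacobian f (at (X 0 \<omega>))))\<^sup>2)"
    using \<open>0 \<le> c\<close> by (simp add: eexpectation_nonneg less_eq_ennreal.rep_eq enn2ereal_ennreal)
  also have "\<dots> \<le> M_const P T f X"
    unfolding M_const_def using \<open>0 \<le> T\<close> by (intro SUP_upper) simp
  finally show ?thesis .
qed

section \<open>Nonnegativity of the constant built from the noise\<close>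

text \<open>
  If some diagonal expectation is infinite, the sum is \<open>\<infinity>\<close>, as \<open>\<infinity> + (- \<infinity>) = \<infinity>\<close> in \<open>ereal\<close>.
  Otherwise all entries are integrable by Cauchy-Schwarz.
\<close>

lemma sum_eexpectation_Gram_nonneg:
  fixes a :: "'k::finite \<Rightarrow> 'w \<Rightarrow> 'v::euclidean_space"
  assumes [measurable]: "\<And>k. a k \<in> borel_measurable P" and "0 < c"
  shows "0 \<le> (\<Sum>k\<in>UNIV. \<Sum>l\<in>UNIV. eexpectation P (\<lambda>\<omega>. a k \<omega> \<bullet> a l \<omega>) / ereal c)"
proof (cases "\<forall>k. integrable P (\<lambda>\<omega>. (norm (a k \<omega>))\<^sup>2)")
  case True
  have int: "integrable P (\<lambda>\<omega>. a k \<omega> \<bullet> a l \<omega>)" for k l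
  proof (rule Bochner_Integration.integrable_bound)
    show "integrable P (\<lambda>\<omega>. (norm (a k \<omega>))\<^sup>2 + (norm (a l \<omega>))\<^sup>2)"
      using True by (intro Bochner_Integration.integrable_add) auto
    have "\<bar>x \<bullet> y\<bar> \<le> (norm x)\<^sup>2 + (norm y)\<^sup>2" for x y :: 'v
    proof -
      have "\<bar>x \<bullet> y\<bar> \<le> norm x * norm y" by (rule Cauchy_Schwarz_ineq2)
      moreover have "2 * norm x * norm y \<le> (norm x)\<^sup>2 + (norm y)\<^sup>2" by (rule sum_squares_bound)
      moreover have "0 \<le> norm x * norm y" by simp
      ultimately show ?thesis by linarith
    qed
    then show "AE \<omega> in P. norm (a k \<omega> \<bullet> a l \<omega>) \<le> norm ((norm (a k \<omega>))\<^sup>2 + (norm (a l \<omega>))\<^sup>2)"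
      by (intro AE_I2) simp
  qed simp
  have "(\<Sum>k\<in>UNIV. \<Sum>l\<in>UNIV. integral\<^sup>L P (\<lambda>\<omega>. a k \<omega> \<bullet> a l \<omega>))
      = integral\<^sup>L P (\<lambda>\<omega>. (\<Sum>k\<in>UNIV. a k \<omega>) \<bullet> (\<Sum>l\<in>UNIV. a l \<omega>))"
    using int by (simp add: inner_sum_left inner_sum_right) (rule sum.swap)
  then have "0 \<le> (\<Sum>k\<in>UNIV. \<Sum>l\<in>UNIV. integral\<^sup>L P (\<lambda>\<omega>. a k \<omega> \<bullet> a l \<omega>))" by simp
  then show ?thesis
    using \<open>0 < c\<close> int by (simp add: eexpectation_integrable flip: sum_divide_distrib)
next
  case False
  then obtain k where "\<not> integrable P (\<lambda>\<omega>. (norm (a k \<omega>))\<^sup>2)" by blast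
  then have "(\<integral>\<^sup>+\<omega>. ennreal ((norm (a k \<omega>))\<^sup>2) \<partial>P) = \<infinity>"
    by (simp add: integrable_iff_bounded not_less top_unique)
  then have "eexpectation P (\<lambda>\<omega>. a k \<omega> \<bullet> a k \<omega>) / ereal c = \<infinity>"
    using \<open>0 < c\<close> by (simp add: eexpectation_nonneg flip: power2_norm_eq_inner)
  then have "(\<Sum>k\<in>UNIV. \<Sum>l\<in>UNIV. eexpectation P (\<lambda>\<omega>. a k \<omega> \<bullet> a l \<omega>) / ereal c) = \<infinity>"
    by (auto simp: sum_Pinfty)
  then show ?thesis by simp
qed

lemma C1_map_continuous:
  assumes "C1_map g"
  shows "continuous_on UNIV g"
  using assms unfolding C1_map_def continuous_on_eq_continuous_at[OF open_UNIV]
  by (blast intro: has_derivative_continuous)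

text \<open>Taking a column is linear and bounded, so it commutes with differentiation. This makes
  the factors of \<open>milstein_h\<close> Borel functions of the state.\<close>

lemma continuous_partial_deriv_column:
  fixes g :: "real^'d \<Rightarrow> real^'m^'d"
  assumes "C1_map g"
  shows "continuous_on UNIV (partial_deriv (\<lambda>z. column j (g z)) k)"
proof -
  obtain g' :: "real^'d \<Rightarrow> (real^'d) \<Rightarrow>\<^sub>L (real^'m^'d)" where
    g': "\<And>x. (g has_derivative blinfun_apply (g' x)) (at x)" and cont: "continuous_on UNIV g'"
    using assms unfolding C1_map_def by blast
  have bl: "bounded_linear (\<lambda>A :: real^'m^'d. column j A)"
    by (intro linear_conv_bounded_linear[THEN iffD1] linearI)
       (auto simp: column_def vec_eq_iff)
  have "frechet_derivative (\<lambda>z. column j (g z)) (at x) = (\<lambda>v. column j (g' x v))" for x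
    using bounded_linear.has_derivative[OF bl g'] by (rule frechet_derivative_at[symmetric])
  then have "partial_deriv (\<lambda>z. column j (g z)) k = (\<lambda>x. column j (g' x (axis k 1)))"
    by (simp add: partial_deriv_def fun_eq_iff)
  moreover have "continuous_on UNIV (\<lambda>x. column j (g' x (axis k 1)))"
    by (intro bounded_linear.continuous_on[OF bl] continuous_intros cont)
  ultimately show ?thesis by simp
qed

lemma Mtilde_const_nonneg:
  fixes g :: "real^'d \<Rightarrow> real^'m^'d"
  assumes "C1_map g" and "0 \<le> T"
    and [measurable]: "X 0 \<in> borel_measurable P" "Y 0 \<in> borel_measurable P"
  shows "0 \<le> Mtilde_const P T g X Y"
proof -
  define D where "D = eexpectation P (\<lambda>\<omega>. (norm (X 0 \<omega> - Y 0 \<omega>))\<^sup>2)"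
  define q where "q i j k l = eexpectation P (\<lambda>\<omega>. milstein_h g i j k l (X 0 \<omega>) (Y 0 \<omega>)) / D"
    for i j :: 'm and k l :: 'd
  define b where "b i j k x = (g x $ k $ i) *\<^sub>R partial_deriv (\<lambda>z. column j (g z)) k x"
    for i j :: 'm and k x
  have "continuous_on UNIV (b i j k)" for i j k
    unfolding b_def
    by (intro continuous_intros C1_map_continuous continuous_partial_deriv_column assms)
  then have b[measurable]: "b i j k \<in> borel_measurable borel" for i j k
    by (rule borel_measurable_continuous_onI)
  have h: "milstein_h g i j k l x y = (b i j k x - b i j k y) \<bullet> (b i j l x - b i j l y)"
    for i j k l x y by (simp add: milstein_h_def b_def)
  have D: "D = enn2ereal (\<integral>\<^sup>+\<omega>. ennreal ((norm (X 0 \<omega> - Y 0 \<omega>))\<^sup>2) \<partial>P)"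
    by (simp add: D_def eexpectation_nonneg)
  have "0 \<le> (\<Sum>k\<in>UNIV. \<Sum>l\<in>UNIV. q i j k l)" for i j
  proof -
    \<comment> \<open>If \<open>D = 0\<close>, the initial values agree almost surely, every
      numerator vanishes, and 0/0 is 0. If \<open>D = \<infinity>\<close>, every quotient is 0, even
      with an infinite numerator. Otherwise the Gram sum is divided by a positive real.\<close>
    consider "D = 0" | "D = \<infinity>" | c where "D = ereal c" "0 < c"
    proof (cases D)
      case (real r)
      moreover have "0 \<le> D" by (simp add: D)
      ultimately show ?thesis using that by (cases "r = 0") (auto simp: zero_ereal_def)
    qed (use that in \<open>auto simp: D\<close>)
    then show ?thesis
    proof cases
      case 1
      then have "(\<integral>\<^sup>+\<omega>. ennreal ((norm (X 0 \<omega> - Y 0 \<omega>))\<^sup>2) \<partial>P) = 0"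
        by (metis D enn2ereal_inject zero_ennreal.rep_eq)
      then have "AE \<omega> in P. X 0 \<omega> = Y 0 \<omega>"
        by (subst (asm) nn_integral_0_iff_AE) (auto simp: ennreal_eq_0_iff)
      then have "AE \<omega> in P. milstein_h g i j k l (X 0 \<omega>) (Y 0 \<omega>) = 0" for k l
        by eventually_elim (simp add: h)
      then have "eexpectation P (\<lambda>\<omega>. milstein_h g i j k l (X 0 \<omega>) (Y 0 \<omega>)) = eexpectation P (\<lambda>_. 0)" for k l
        by (rule eexpectation_cong_AE)
      then show ?thesis by (simp add: q_def eexpectation_nonneg zero_ennreal.rep_eq)
    next
      case 2
      then show ?thesis by (simp add: q_def)
    next
      case 3
      then show ?thesis
        unfolding q_def h by (simp add: sum_eexpectation_Gram_nonneg)
    qed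
  qed
  then have "0 \<le> (\<Sum>i\<in>UNIV. \<Sum>j\<in>UNIV. \<Sum>k\<in>UNIV. \<Sum>l\<in>UNIV. q i j k l)"
    by (meson sum_nonneg)
  also have "\<dots> \<le> Mtilde_const P T g X Y"
    unfolding Mtilde_const_def q_def D_def using \<open>0 \<le> T\<close> by (intro sum_mono SUP_upper) simp
  finally show ?thesis .
qed

section \<open>Real inequalities for gamma and the step size region\<close>

text \<open>The bound on \<open>M\<close> is asked for only if \<open>\<theta> \<noteq> 1\<close>:
  at \<open>\<theta> = 1\<close> an infinite constant may have been turned into the real number 0,
  but then its coefficient vanishes.\<close>

lemma milstein_gamma_bounds:
  assumes "\<mu> < 0" "0 < L" "\<alpha> = 2 * \<mu> + L" "0 < \<Delta>t" "0 \<le> \<theta>"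
    and M: "\<theta> \<noteq> 1 \<Longrightarrow> \<mu>\<^sup>2 \<le> M" and "0 \<le> Mt"
    and small: "\<Delta>t * (4 * (1 - \<theta>)\<^sup>2 * M + 3 * Mt) < 4 * \<bar>\<alpha>\<bar>" and "\<alpha> < 0"
  shows "0 < milstein_gamma \<alpha> \<mu> M Mt \<theta> \<Delta>t" and "milstein_gamma \<alpha> \<mu> M Mt \<theta> \<Delta>t < 1"
proof -
  define E where "E = 1 - 2 * \<theta> * \<mu> * \<Delta>t"
  define N where "N = \<alpha> * \<Delta>t + ((1 - \<theta>)\<^sup>2 * M + 3 * Mt / 4) * \<Delta>t\<^sup>2"
  have "\<theta> * \<mu> * \<Delta>t \<le> 0"
    using assms by (simp add: mult_nonneg_nonpos mult_nonpos_nonneg)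
  then have "E > 0" by (simp add: E_def)
  \<comment> \<open>Over the common denominator \<open>E\<close>, the upper bound becomes
    \<open>N < 0\<close> and the lower bound \<open>0 < E + N\<close>.\<close>
  then have gamma: "milstein_gamma \<alpha> \<mu> M Mt \<theta> \<Delta>t = 1 + N / E"
    unfolding milstein_gamma_def milstein_beta_def E_def[symmetric] N_def
    by (simp add: field_simps power2_eq_square)
  have "N = \<Delta>t * (\<Delta>t * (4 * (1 - \<theta>)\<^sup>2 * M + 3 * Mt) - 4 * \<bar>\<alpha>\<bar>) / 4"
    using \<open>\<alpha> < 0\<close> by (simp add: N_def field_simps power2_eq_square)
  also have "\<dots> < 0" using small \<open>0 < \<Delta>t\<close> by (simp add: mult_pos_neg)
  finally show "milstein_gamma \<alpha> \<mu> M Mt \<theta> \<Delta>t < 1"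
    using \<open>E > 0\<close> by (simp add: gamma divide_neg_pos)
  have "(1 - \<theta>)\<^sup>2 * \<mu>\<^sup>2 \<le> (1 - \<theta>)\<^sup>2 * M"
    using M by (cases "\<theta> = 1") (auto intro: mult_left_mono)
  then have "(1 - \<theta>)\<^sup>2 * \<mu>\<^sup>2 * \<Delta>t\<^sup>2 \<le> ((1 - \<theta>)\<^sup>2 * M + 3 * Mt / 4) * \<Delta>t\<^sup>2"
    using \<open>0 \<le> Mt\<close> by (intro mult_right_mono) auto
  moreover have "0 \<le> (1 + (1 - \<theta>) * \<mu> * \<Delta>t)\<^sup>2" and "0 < L * \<Delta>t" using assms by auto
  \<comment> \<open>\<open>E + N\<close> is the completed square plus \<open>L * \<Delta>t\<close>
    plus the nonnegative gap in the preceding comparison of the quadratic terms.\<close>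
  ultimately have "0 < E + N"
    unfolding E_def N_def assms(3) by (simp add: algebra_simps power2_eq_square)
  then show "0 < milstein_gamma \<alpha> \<mu> M Mt \<theta> \<Delta>t"
    using \<open>E > 0\<close> by (simp add: gamma field_simps)
qed

text \<open>An infinite \<open>c\<close> would make the quotient 0, contradicting
  \<open>0 < t\<close>. The case \<open>r = 0\<close> stands apart because division of a positive
  number by 0 gives infinity and so no bound on \<open>t\<close>.\<close>

lemma ereal_less_divideD:
  fixes c :: ereal
  assumes "ereal t < ereal a / c" and "0 < t" and "0 \<le> c" and "0 \<le> a"
  shows "\<exists>r. c = ereal r \<and> (r = 0 \<or> t * r < a)"
  using assms by (cases c) (auto simp: field_simps split: if_splits)

lemma contractivity_regionD:
  assumes "\<Delta>t \<in> contractivity_region \<alpha> M Mt \<theta>" and "0 \<le> M" and "0 \<le> Mt" and "\<alpha> < 0" and "\<theta> \<le> 1"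
  shows "0 < \<Delta>t" and "\<theta> \<noteq> 1 \<Longrightarrow> ereal (real_of_ereal M) = M"
    and "\<Delta>t * (4 * (1 - \<theta>)\<^sup>2 * real_of_ereal M + 3 * real_of_ereal Mt) < 4 * \<bar>\<alpha>\<bar>"
proof -
  define c where "c = (if \<theta> < 1 then ereal (4 * (1 - \<theta>)\<^sup>2) * M + ereal 3 * Mt else ereal 3 * Mt)"
  have t: "0 < \<Delta>t" and "ereal \<Delta>t < ereal (4 * \<bar>\<alpha>\<bar>) / c"
    using assms(1) by (auto simp: contractivity_region_def c_def split: if_splits)
  moreover have "0 \<le> c" using assms by (auto simp: c_def)
  ultimately obtain r where r: "c = ereal r" "r = 0 \<or> \<Delta>t * r < 4 * \<bar>\<alpha>\<bar>"
    using ereal_less_divideD[of \<Delta>t "4 * \<bar>\<alpha>\<bar>" c] by auto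
  show "0 < \<Delta>t" by fact
  \<comment> \<open>For \<open>\<theta> < 1\<close> both terms of \<open>c\<close> are nonnegative
    and \<open>M\<close> has a positive coefficient, so a finite \<open>c\<close> forces a finite
    \<open>M\<close>. For \<open>\<theta> = 1\<close> only \<open>Mt\<close> is controlled.\<close>
  show fin: "ereal (real_of_ereal M) = M" if "\<theta> \<noteq> 1"
    using r(1) that assms by (cases M; cases Mt) (auto simp: c_def split: if_splits)
  have "r = 4 * (1 - \<theta>)\<^sup>2 * real_of_ereal M + 3 * real_of_ereal Mt"
    using r(1) fin assms by (cases M; cases Mt) (auto simp: c_def split: if_splits)
  then show "\<Delta>t * (4 * (1 - \<theta>)\<^sup>2 * real_of_ereal M + 3 * real_of_ereal Mt) < 4 * \<bar>\<alpha>\<bar>"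
    \<comment> \<open>For \<open>r = 0\<close> the claim reduces to
      \<open>0 < 4 * \<bar>\<alpha>\<bar>\<close>.\<close>
    using r(2) \<open>\<alpha> < 0\<close> by auto
qed

theorem mainTheorem4:
  fixes P :: "'w measure" and F :: "real \<Rightarrow> 'w measure" and W :: "real \<Rightarrow> 'w \<Rightarrow> real^'m"
    and f :: "real^'d \<Rightarrow> real^'d" and g :: "real^'d \<Rightarrow> real^'m^'d"
    and X Y :: "real \<Rightarrow> 'w \<Rightarrow> real^'d"
    and \<mu> L \<alpha> \<theta> T :: real and M Mt :: ereal and R :: "real set"
  assumes "wiener_process P F W"
    and "C1_map f" and "C1_map g"
    and "L > 0"
    and "\<And>x y. (x - y) \<bullet> (f x - f y) \<le> \<mu> * (norm (x - y))\<^sup>2"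
    and "\<And>x y. (norm (g x - g y))\<^sup>2 \<le> L * (norm (x - y))\<^sup>2"
    and "\<alpha> = 2 * \<mu> + L" and "\<alpha> < 0"
    and "commutative_noise g"
    and "\<theta> \<in> {0..1}"
    and "T > 0"
    and "sde_solution P F W T f g X" and "sde_solution P F W T f g Y"
    and "eexpectation P (\<lambda>\<omega>. (norm (X 0 \<omega>))\<^sup>2) < \<infinity>"
    and "eexpectation P (\<lambda>\<omega>. (norm (Y 0 \<omega>))\<^sup>2) < \<infinity>"
    and "M = M_const P T f X"
    and "Mt = Mtilde_const P T g X Y"
    and "R = contractivity_region \<alpha> M Mt \<theta>"
  shows "(\<forall>\<Delta>t\<in>R. 0 < milstein_gamma \<alpha> \<mu> (real_of_ereal M) (real_of_ereal Mt) \<theta> \<Delta>t \<and>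
                  milstein_gamma \<alpha> \<mu> (real_of_ereal M) (real_of_ereal Mt) \<theta> \<Delta>t < 1) \<and>
         mean_square_contractive \<alpha> \<mu> (real_of_ereal M) (real_of_ereal Mt) \<theta> R"
proof -
  have "prob_space P" and "sets (F 0) \<subseteq> sets P" and "space (F 0) = space P"
    using assms(1) by (auto simp: wiener_process_def filtration_def)
  then have sub: "subalgebra P (F 0)" by (simp add: subalgebra_def)
  have "X 0 \<in> borel_measurable (F 0)" "Y 0 \<in> borel_measurable (F 0)"
    using assms(11-13) by (auto simp: sde_solution_def)
  then have meas: "X 0 \<in> borel_measurable P" "Y 0 \<in> borel_measurable P"
    using measurable_from_subalg[OF sub] by blast+
  have "\<mu> < 0" using assms(4,7,8) by simp
  have "f differentiable (at x)" for x
    using assms(2) by (auto simp: C1_map_def differentiable_def)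
  then have "ereal (\<mu>\<^sup>2) \<le> M"
    unfolding assms(16) using norm_jacobian_ge[OF assms(5)] \<open>\<mu> < 0\<close> \<open>T > 0\<close> \<open>prob_space P\<close>
    by (intro M_const_ge) auto
  moreover from this have "0 \<le> M" by (rule order_trans[rotated]) simp
  moreover have "0 \<le> Mt"
    unfolding assms(17) using \<open>T > 0\<close> by (intro Mtilde_const_nonneg assms(3) meas) simp
  moreover have "0 \<le> \<theta>" "\<theta> \<le> 1" using assms(10) by auto
  ultimately have bounds: "0 < \<Delta>t \<and> 0 < milstein_gamma \<alpha> \<mu> (real_of_ereal M) (real_of_ereal Mt) \<theta> \<Delta>t
      \<and> milstein_gamma \<alpha> \<mu> (real_of_ereal M) (real_of_ereal Mt) \<theta> \<Delta>t < 1" if "\<Delta>t \<in> R" for \<Delta>t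
  proof -
    note region = contractivity_regionD[OF that[unfolded assms(18)] \<open>0 \<le> M\<close> \<open>0 \<le> Mt\<close> \<open>\<alpha> < 0\<close> \<open>\<theta> \<le> 1\<close>]
    \<comment> \<open>The bound passes to the real number only for finite \<open>M\<close>, since
      \<open>real_of_ereal\<close> sends infinity to 0.\<close>
    have "\<mu>\<^sup>2 \<le> real_of_ereal M" if "\<theta> \<noteq> 1"
      using region(2)[OF that] \<open>ereal (\<mu>\<^sup>2) \<le> M\<close> by (metis ereal_less_eq(3))
    moreover have "0 \<le> real_of_ereal Mt" using \<open>0 \<le> Mt\<close> by (rule real_of_ereal_pos)
    ultimately show ?thesis
      using milstein_gamma_bounds[OF \<open>\<mu> < 0\<close> assms(4,7) region(1) \<open>0 \<le> \<theta>\<close> _ _ region(3) \<open>\<alpha> < 0\<close>]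
        region(1) by blast
  qed
  moreover have "milstein_epsilon \<alpha> \<mu> (real_of_ereal M) (real_of_ereal Mt) \<theta> \<Delta>t < 0" if "\<Delta>t \<in> R" for \<Delta>t
    using bounds[OF that] by (simp add: milstein_epsilon_def divide_neg_pos)
  ultimately show ?thesis by (auto simp: mean_square_contractive_def)
qed

end
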